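(* Let $(u,b)$ be a weak solution of the MHD system with initial data $(u_0,b_0)\in B_R(0)$ and forces $f_1,f_2\in L^\infty_{loc}([0,\infty);H^{-1}(D)\cap L^2(D))$, and let $R(\cdot)$ be a non-negative function such that for every $T>0$ $$\|u(\cdot,T)\|_{L^2}^2+\|b(\cdot,T)\|_{L^2}^2+\min(\nu,\eta)\int_0^T\big(\|\nabla u(\cdot,s)\|_{L^2}^2+\|\nabla b(\cdot,s)\|_{L^2}^2\big)\,ds\le R^2(T)$$ and $\|\widehat u(\cdot,t)\|_{L^2}^2+\|\widehat b(\cdot,t)\|_{L^2}^2\le R^2(t)$ for all $t$. Suppose that there is a non-decreasing function $R_1(t)$ such that for every $k\in\mathbb{R}^3\setminus\{0\}$ (with its associated $\delta$, $\widehat\chi_k$, $e_p$, $h_p$): $$2^{1/p}(2\delta)^{3/p}R^2(t)+2h_p(k,t)<\frac{\min(\nu,\eta)}{6}R_1(t)\quad\text{for all }2\le p<\infty,\ t\in[0,\infty),\qquad \sup_{2\le p<\infty}e_p(k,0)<\frac{R_1(0)}{|k|},$$ where $R(t)\equiv R$ and $R_1(t)\equiv R_1$ are constants when $f_1\equiv f_2\equiv0$. Suppose also that for every $T>0$ $$F_\infty(T):=\sup_{k\in\mathbb{R}^3\setminus\{0\}}\Big(\int_0^T\|\widehat\chi_k\widehat f_1(\cdot,t)\|_{L^\infty}^2+\|\widehat\chi_k\widehat f_2(\cdot,t)\|_{L^\infty}^2\,dt\Big)^{1/2}<\infty,$$ and put $$R_2(T)=\frac12\Big(R_3(T)+\sqrt{4R_1^2(0)+R_3^2(T)}\Big),\qquad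 R_3(T)=\frac{2R^2(T)}{\min(\nu,\eta)}+\frac{2F_\infty(T)}{\sqrt{\min(\nu,\eta)}}.$$ Let $C_0,\epsilon>0$ and $T>0$. Then the following hold for the inertial range of the MHD system: (1) A necessary condition on the parameters for $E(k,t)$ to exhibit K-41 like phenomenon is $$\big(\min(\nu,\eta)\big)^{5/6}C_0\,\epsilon^{2/3}\le4\pi\Big(\frac{R_2(T)}{\sqrt T}\Big)^{5/3}R_1^{1/3}(T).$$ (2) An absolute lower bound for the inertial range is $$k_1=\frac{C_0^{3/5}\epsilon^{2/5}}{(4\pi R_1^2)^{3/5}},\qquad R_1=R_1(T).$$ (3) An absolute upper bound for the inertial range is $$k_2=\Big(\frac{4\pi}{C_0\min(\nu,\eta)}\Big)^3\frac1{\epsilon^2}\frac{R_2^6(T)}{T^3}.$$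
   Context: MHD system. Let $D=\mathbb{R}^3$, $\nu,\eta>0$. The system is $$\partial_t u+(u\cdot\nabla)u+\nabla\pi-(b\cdot\nabla)b-\nu\Delta u=f_1,\quad \partial_t b+(u\cdot\nabla)b-(b\cdot\nabla)u-\eta\Delta b=f_2 \quad\text{on }(0,\infty)\times D,$$ $$\operatorname{div}u=\operatorname{div}b=0,\qquad u|_{t=0}=u_0,\quad b|_{t=0}=b_0,$$ where $u(x,t),b(x,t)$ are the velocity and magnetic fields, $\pi$ is the total pressure, and $f_1,f_2$ are divergence-free. $B_R(0)$ is the ball in $L^2(D)$ of radius $R$ centered at $0$. Function spaces. $L^2_\sigma$ and $H^1_\sigma$ are the closures, in the $L^2$ and $H^1$ norms, of the divergence-free smooth compactly supported vector fields on $D$. Weak solution. For $(u_0,b_0)\in L^2_\sigma(D)$, a pair $(u,b)$ is a weak solution on $D\times[0,\infty)$ if: (1) for every $T>0$, $u,b\in L^\infty([0,T);L^2_\sigma)\cap L^2([0,T);H^1_\sigma)$; (2) for every $T>0$ and all $(\Phi,\Psi)$ in $H^1((0,T);H^1_\sigma\cap L^2)$ with $\Phi(T)=\Psi(T)=0$, $$\int_0^T\{-(u,\partial_t\Phi)+\nu(\nabla u,\nabla\Phi)+(u\cdot\nabla u,\Phi)-(b\cdot\nabla b,\Phi)\}dt=(u_0,\Phi(0))+\int_0^T(f_1,\Phi)dt,$$ $$\int_0^T\{-(b,\partial_t\Psi)+\eta(\nabla b,\nabla\Psi)+(u\cdot\nabla b,\Psi)-(b\cdot\nabla u,\Psi)\}dt=(b_0,\Psi(0))+\int_0^T(f_2,\Psi)dt,$$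 and $u(\cdot,t)\to u_0$, $b(\cdot,t)\to b_0$ strongly in $L^2$ as $t\to0^+$; (3) for all $0<t<\infty$, $$\tfrac12\int_D(|u(x,t)|^2+|b(x,t)|^2)dx+\min(\nu,\eta)\int_0^t\!\int_D(|\nabla u|^2+|\nabla b|^2)dx\,ds-\int_0^t\!\int_D(u\cdot f_1+b\cdot f_2)dx\,ds\le\tfrac12\int_D(|u_0|^2+|b_0|^2)dx.$$ Fourier transform: $\widehat u(\xi)=\int_D e^{-i\xi\cdot x}u(x)\,dx$ (in the space variable). Cutoff. For each $k\in\mathbb{R}^3\setminus\{0\}$ a number $0<\delta<\frac{|k|}{2\sqrt3}$ is fixed, and $\widehat\chi_k$ is a smooth cutoff function with values in $[0,1]$, supported in the cube $Q_k$ centered at $k$ with side length $2\delta$ (so its support lies in $\{\frac{|k|}2\le|\xi|\le\frac32|k|\}$), and equal to $1$ on the cube with the same center and side $\delta$. For $2\le p<\infty$, $$e_p(k,t)=\Big(\int_D|\widehat\chi_k(\xi)\widehat u(\xi,t)|^p+|\widehat\chi_k(\xi)\widehat b(\xi,t)|^p\,d\xi\Big)^{1/p},$$ $$h_p(k,t)=\sup_{0\le s\le t}\Big(\int_D\frac{|\widehat\chi_k(\xi)\widehat f_1(\xi,s)|^p+|\widehat\chi_k(\xi)\widehat f_2(\xi,s)|^p}{|\xi|^p}\,d\xi\Big)^{1/p}.$$ Spectral energy function. For a radial coordinate $k\in[0,\infty)$ in Fourier space, $$E(k,t)=\int_{|\xi|=k}\big(|\widehat u(\xi,t)|^2+|\widehat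 b(\xi,t)|^2\big)\,dS(\xi).$$ Kolmogorov spectral function and inertial range. $E_K(k)=C_0\epsilon^{2/3}k^{-5/3}$ for $k>0$, with $C_0$ the Kolmogorov constant and $\epsilon$ the energy dissipation rate. For given $T>0$, let $$S=\Big\{(k,E): 0\le E\le4\pi R_1^2(T),\ 0\le E\le\frac{4\pi R_2^2(T)}{\min(\nu,\eta)\,T\,k^2}\Big\}$$ (the region determined by the bounds $E(k,t)\le 4\pi R_1^2$ on the spectral energy and $\frac1T\int_0^TE(k,t)dt\le\frac{4\pi R_2^2(T)}{\min(\nu,\eta)Tk^2}$ on its time average), and let $A=\{(k,E):E=E_K(k)\}\cap S$ be the part of the graph of $E_K$ lying in $S$. "$E(k,t)$ exhibits K-41 like phenomenon" requires $A\neq\emptyset$ (if $A=\emptyset$ it does not), and the inertial range is the set of wave numbers $k>0$ with $(k,E_K(k))\in A$. "Absolute lower (upper) bound for the inertial range" means that every $k$ in the inertial range satisfies $k\ge k_1$ (respectively $k\le k_2$). *)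

theory Defs
  imports "HOL-Analysis.Analysis" "HOL-Probability.Essential_Supremum"
begin

type_synonym vec3 = "real ^ 3"
type_synonym vfield = "vec3 \<Rightarrow> vec3"


section \<open>Test functions\<close>

primrec Ck :: "nat \<Rightarrow> ('a::real_normed_vector \<Rightarrow> 'b::real_normed_vector) \<Rightarrow> bool" where
  "Ck 0 f \<longleftrightarrow> continuous_on UNIV f"
| "Ck (Suc n) f \<longleftrightarrow>
     (\<forall>x. f differentiable (at x)) \<and> (\<forall>v. Ck n (\<lambda>x. frechet_derivative f (at x) v))"

definition smooth :: "('a::euclidean_space \<Rightarrow> 'b::real_normed_vector) \<Rightarrow> bool" where
  "smooth f \<longleftrightarrow> (\<forall>n. Ck n f)"

definition test_functions :: "'a::euclidean_space set \<Rightarrow> ('a \<Rightarrow> 'b::real_normed_vector) set" where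
  "test_functions S =
     {f. smooth f \<and> compact (closure {x. f x \<noteq> 0}) \<and> closure {x. f x \<noteq> 0} \<subseteq> S}"

definition partial_deriv :: "3 \<Rightarrow> (vec3 \<Rightarrow> real) \<Rightarrow> vec3 \<Rightarrow> real" where
  "partial_deriv j f x = frechet_derivative f (at x) (axis j 1)"

definition divergence :: "vfield \<Rightarrow> vec3 \<Rightarrow> real" where
  "divergence f x = (\<Sum>j\<in>UNIV. partial_deriv j (\<lambda>y. f y $ j) x)"

definition solenoidal_test_fields :: "vfield set" where
  "solenoidal_test_fields = {\<phi> \<in> test_functions UNIV. \<forall>x. divergence \<phi> x = 0}"


section \<open>Function spaces\<close>

text \<open>Elements of the spaces below are functions, not classes modulo null sets; every notion
  is invariant under changes on null sets.\<close>

definition L2 :: "(vec3 \<Rightarrow> 'b::euclidean_space) set" where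
  "L2 = {f \<in> borel_measurable lebesgue. integrable lebesgue (\<lambda>x. (norm (f x))\<^sup>2)}"

definition L2_norm :: "(vec3 \<Rightarrow> 'b::euclidean_space) \<Rightarrow> real" where
  "L2_norm f = sqrt (LINT x|lebesgue. (norm (f x))\<^sup>2)"

definition L2_inner :: "(vec3 \<Rightarrow> 'b::euclidean_space) \<Rightarrow> (vec3 \<Rightarrow> 'b) \<Rightarrow> real" where
  "L2_inner f g = (LINT x|lebesgue. f x \<bullet> g x)"

text \<open>Entry \<open>G x $ i $ j\<close> of a gradient is the \<open>j\<close>-th partial derivative of the \<open>i\<close>-th
  component; the norm and inner product of \<open>real ^ 3 ^ 3\<close> are the Frobenius ones.\<close>

definition is_weak_grad :: "vfield \<Rightarrow> (vec3 \<Rightarrow> real ^ 3 ^ 3) \<Rightarrow> bool" where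
  "is_weak_grad u G \<longleftrightarrow>
     (\<forall>\<phi>\<in>test_functions UNIV. \<forall>i j.
        (LINT x|lebesgue. u x $ i * partial_deriv j \<phi> x) = - (LINT x|lebesgue. G x $ i $ j * \<phi> x))"

definition H1 :: "vfield set" where
  "H1 = {u \<in> L2. \<exists>G\<in>L2. is_weak_grad u G}"

text \<open>Determined up to null sets for fields in \<open>H1\<close>.\<close>

definition weak_grad :: "vfield \<Rightarrow> vec3 \<Rightarrow> real ^ 3 ^ 3" where
  "weak_grad u = (SOME G. G \<in> L2 \<and> is_weak_grad u G)"

definition H1_norm :: "vfield \<Rightarrow> real" where
  "H1_norm u = sqrt ((L2_norm u)\<^sup>2 + (L2_norm (weak_grad u))\<^sup>2)"

definition L2_sigma :: "vfield set" where
  "L2_sigma = {u \<in> L2. \<forall>e>0. \<exists>\<phi>\<in>solenoidal_test_fields. L2_norm (\<lambda>x. u x - \<phi> x) < e}"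

definition H1_sigma :: "vfield set" where
  "H1_sigma = {u \<in> H1. \<forall>e>0. \<exists>\<phi>\<in>solenoidal_test_fields. H1_norm (\<lambda>x. u x - \<phi> x) < e}"

text \<open>\<open>H1\<close> and its dual are inhomogeneous; an \<open>L2\<close> field acts on test fields by the
  \<open>L2\<close> inner product.\<close>

definition Hm1_norm :: "vfield \<Rightarrow> real" where
  "Hm1_norm f = (SUP \<phi>\<in>{\<phi>\<in>test_functions UNIV. H1_norm \<phi> \<le> 1}. \<bar>L2_inner f \<phi>\<bar>)"

definition Hm1_L2 :: "vfield set" where
  "Hm1_L2 = {f \<in> L2. \<exists>C. \<forall>\<phi>\<in>test_functions UNIV. \<bar>L2_inner f \<phi>\<bar> \<le> C * H1_norm \<phi>}"

definition weakly_div_free :: "vfield \<Rightarrow> bool" where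
  "weakly_div_free f \<longleftrightarrow>
     (\<forall>\<phi>\<in>test_functions UNIV. (LINT x|lebesgue. f x \<bullet> (\<chi> j. partial_deriv j \<phi> x)) = 0)"


section \<open>Time-dependent fields\<close>

text \<open>A strongly measurable map into a space of \<open>L2\<close> fields is represented by a function
  that is jointly Lebesgue measurable in time and space.\<close>

definition spacetime_measurable :: "real set \<Rightarrow> (real \<Rightarrow> vfield) \<Rightarrow> bool" where
  "spacetime_measurable I u \<longleftrightarrow> set_borel_measurable lebesgue (I \<times> UNIV) (\<lambda>(t, x). u t x)"

definition Linf_time :: "real set \<Rightarrow> vfield set \<Rightarrow> (vfield \<Rightarrow> real) \<Rightarrow> (real \<Rightarrow> vfield) set" where
  "Linf_time I X N =
     {u. spacetime_measurable I u \<and>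
         (AE t in lebesgue. t \<in> I \<longrightarrow> u t \<in> X) \<and>
         (\<exists>C. AE t in lebesgue. t \<in> I \<longrightarrow> N (u t) \<le> C)}"

definition L2_time :: "real set \<Rightarrow> vfield set \<Rightarrow> (vfield \<Rightarrow> real) \<Rightarrow> (real \<Rightarrow> vfield) set" where
  "L2_time I X N =
     {u. spacetime_measurable I u \<and>
         (AE t in lebesgue. t \<in> I \<longrightarrow> u t \<in> X) \<and>
         set_integrable lebesgue I (\<lambda>t. (N (u t))\<^sup>2)}"

definition is_weak_time_deriv :: "real \<Rightarrow> (real \<Rightarrow> vfield) \<Rightarrow> (real \<Rightarrow> vfield) \<Rightarrow> bool" where
  "is_weak_time_deriv T \<Phi> \<Phi>' \<longleftrightarrow>
     (\<forall>\<theta>\<in>test_functions {0<..<T}. AE x in lebesgue.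
        (LINT t:{0<..<T}|lebesgue. deriv \<theta> t *\<^sub>R \<Phi> t x)
          = - (LINT t:{0<..<T}|lebesgue. (\<theta> t :: real) *\<^sub>R \<Phi>' t x))"

text \<open>\<open>\<Phi>\<close> lies in $H^1((0,T); H^1_\sigma)$, with time derivative \<open>\<Phi>'\<close>. It is taken to be the
  representative continuous on the closed interval, so that \<open>\<Phi> 0\<close> and \<open>\<Phi> T\<close> are its traces.\<close>

definition H1_time :: "real \<Rightarrow> (real \<Rightarrow> vfield) \<Rightarrow> (real \<Rightarrow> vfield) \<Rightarrow> bool" where
  "H1_time T \<Phi> \<Phi>' \<longleftrightarrow>
     \<Phi> \<in> L2_time {0<..<T} (H1_sigma \<inter> L2) H1_norm \<and>
     \<Phi>' \<in> L2_time {0<..<T} (H1_sigma \<inter> L2) H1_norm \<and>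
     is_weak_time_deriv T \<Phi> \<Phi>' \<and>
     (\<forall>t\<in>{0..T}. \<Phi> t \<in> H1_sigma \<inter> L2 \<and>
        ((\<lambda>s. H1_norm (\<lambda>x. \<Phi> s x - \<Phi> t x)) \<longlongrightarrow> 0) (at t within {0..T}))"


section \<open>Weak solutions of the MHD system\<close>

text \<open>\<open>advect u v\<close> is $(u\cdot\nabla)v$.\<close>

definition advect :: "vfield \<Rightarrow> vfield \<Rightarrow> vfield" where
  "advect u v x = weak_grad v x *v u x"

text \<open>The solution is a map from $[0,\infty)$ to \<open>L2_sigma\<close> with a value at every time,
  since the energy inequality is required at every time, and its value at time 0 is the initial
  datum.\<close>

definition mhd_weak_solution ::
  "real \<Rightarrow> real \<Rightarrow> (real \<Rightarrow> vfield) \<Rightarrow> (real \<Rightarrow> vfield) \<Rightarrow> vfield \<Rightarrow> vfield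
     \<Rightarrow> (real \<Rightarrow> vfield) \<Rightarrow> (real \<Rightarrow> vfield) \<Rightarrow> bool"
where
  "mhd_weak_solution \<nu> \<eta> f1 f2 u0 b0 u b \<longleftrightarrow>
     u0 \<in> L2_sigma \<and> b0 \<in> L2_sigma \<and>
     (\<forall>t\<ge>0. u t \<in> L2_sigma \<and> b t \<in> L2_sigma) \<and>
     (AE x in lebesgue. u 0 x = u0 x) \<and> (AE x in lebesgue. b 0 x = b0 x) \<and>
     (\<forall>T>0. u \<in> Linf_time {0..<T} L2_sigma L2_norm \<inter> L2_time {0..<T} H1_sigma H1_norm \<and>
            b \<in> Linf_time {0..<T} L2_sigma L2_norm \<inter> L2_time {0..<T} H1_sigma H1_norm) \<and>
     (\<forall>T>0. \<forall>\<Phi> \<Phi>' \<Psi> \<Psi>'.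
        H1_time T \<Phi> \<Phi>' \<and> H1_time T \<Psi> \<Psi>' \<and>
        (AE x in lebesgue. \<Phi> T x = 0) \<and> (AE x in lebesgue. \<Psi> T x = 0) \<longrightarrow>
          (LINT t:{0..T}|lebesgue.
             - L2_inner (u t) (\<Phi>' t) + \<nu> * L2_inner (weak_grad (u t)) (weak_grad (\<Phi> t))
             + L2_inner (advect (u t) (u t)) (\<Phi> t) - L2_inner (advect (b t) (b t)) (\<Phi> t))
          = L2_inner u0 (\<Phi> 0) + (LINT t:{0..T}|lebesgue. L2_inner (f1 t) (\<Phi> t)) \<and>
          (LINT t:{0..T}|lebesgue.
             - L2_inner (b t) (\<Psi>' t) + \<eta> * L2_inner (weak_grad (b t)) (weak_grad (\<Psi> t))
             + L2_inner (advect (u t) (b t)) (\<Psi> t) - L2_inner (advect (b t) (u t)) (\<Psi> t))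
          = L2_inner b0 (\<Psi> 0) + (LINT t:{0..T}|lebesgue. L2_inner (f2 t) (\<Psi> t))) \<and>
     ((\<lambda>t. L2_norm (\<lambda>x. u t x - u0 x)) \<longlongrightarrow> 0) (at_right 0) \<and>
     ((\<lambda>t. L2_norm (\<lambda>x. b t x - b0 x)) \<longlongrightarrow> 0) (at_right 0) \<and>
     (\<forall>t>0.
        1/2 * ((L2_norm (u t))\<^sup>2 + (L2_norm (b t))\<^sup>2)
        + min \<nu> \<eta> * (LINT s:{0..t}|lebesgue. (L2_norm (weak_grad (u s)))\<^sup>2 + (L2_norm (weak_grad (b s)))\<^sup>2)
        - (LINT s:{0..t}|lebesgue. L2_inner (u s) (f1 s) + L2_inner (b s) (f2 s))
        \<le> 1/2 * ((L2_norm u0)\<^sup>2 + (L2_norm b0)\<^sup>2))"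


section \<open>Fourier side\<close>

definition fourier_trunc :: "nat \<Rightarrow> vfield \<Rightarrow> vec3 \<Rightarrow> complex ^ 3" where
  "fourier_trunc n f \<xi> =
     (\<chi> i. LINT x:cball 0 (real n)|lebesgue. exp (- (\<i> * of_real (\<xi> \<bullet> x))) * of_real (f x $ i))"

text \<open>For a general \<open>L2\<close> field the integral defining the Fourier transform is the \<open>L2\<close> limit of
  the integrals over balls; this determines the transform up to null sets.\<close>

definition fourier :: "vfield \<Rightarrow> vec3 \<Rightarrow> complex ^ 3" where
  "fourier f = (SOME g. g \<in> L2 \<and> (\<lambda>n. L2_norm (\<lambda>\<xi>. g \<xi> - fourier_trunc n f \<xi>)) \<longlonglongrightarrow> 0)"

definition cube :: "vec3 \<Rightarrow> real \<Rightarrow> vec3 set" where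
  "cube k s = {\<xi>. \<forall>i. \<bar>\<xi> $ i - k $ i\<bar> \<le> s / 2}"

definition is_cutoff :: "vec3 \<Rightarrow> real \<Rightarrow> (vec3 \<Rightarrow> real) \<Rightarrow> bool" where
  "is_cutoff k \<delta> X \<longleftrightarrow>
     smooth X \<and> (\<forall>\<xi>. 0 \<le> X \<xi> \<and> X \<xi> \<le> 1) \<and>
     closure {\<xi>. X \<xi> \<noteq> 0} \<subseteq> cube k (2 * \<delta>) \<and> (\<forall>\<xi>\<in>cube k \<delta>. X \<xi> = 1)"

definition epowr :: "ennreal \<Rightarrow> real \<Rightarrow> ennreal" where
  "epowr x r = (if x = \<infinity> then \<infinity> else ennreal (enn2real x powr r))"

text \<open>In the following definitions \<open>X k\<close> is the cutoff at \<open>k\<close>. The quantities may be infinite a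
  priori, hence take values in \<open>ennreal\<close>.\<close>

definition e_p :: "(vec3 \<Rightarrow> vec3 \<Rightarrow> real) \<Rightarrow> (real \<Rightarrow> vfield) \<Rightarrow> (real \<Rightarrow> vfield)
    \<Rightarrow> real \<Rightarrow> vec3 \<Rightarrow> real \<Rightarrow> ennreal" where
  "e_p X u b p k t =
     epowr (\<integral>\<^sup>+\<xi>. ennreal (norm (X k \<xi> *\<^sub>R fourier (u t) \<xi>) powr p
                         + norm (X k \<xi> *\<^sub>R fourier (b t) \<xi>) powr p) \<partial>lebesgue) (1 / p)"

definition h_p :: "(vec3 \<Rightarrow> vec3 \<Rightarrow> real) \<Rightarrow> (real \<Rightarrow> vfield) \<Rightarrow> (real \<Rightarrow> vfield)
    \<Rightarrow> real \<Rightarrow> vec3 \<Rightarrow> real \<Rightarrow> ennreal" where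
  "h_p X f1 f2 p k t =
     (SUP s\<in>{0..t}.
        epowr (\<integral>\<^sup>+\<xi>. ennreal ((norm (X k \<xi> *\<^sub>R fourier (f1 s) \<xi>) powr p
                             + norm (X k \<xi> *\<^sub>R fourier (f2 s) \<xi>) powr p) / norm \<xi> powr p) \<partial>lebesgue)
          (1 / p))"

definition Linf_norm :: "(vec3 \<Rightarrow> complex ^ 3) \<Rightarrow> ennreal" where
  "Linf_norm g = esssup lebesgue (\<lambda>\<xi>. ennreal (norm (g \<xi>)))"

definition F_inf :: "(vec3 \<Rightarrow> vec3 \<Rightarrow> real) \<Rightarrow> (real \<Rightarrow> vfield) \<Rightarrow> (real \<Rightarrow> vfield)
    \<Rightarrow> real \<Rightarrow> ennreal" where
  "F_inf X f1 f2 T =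
     (SUP k\<in>- {0}.
        epowr (\<integral>\<^sup>+t\<in>{0..T}. ((Linf_norm (\<lambda>\<xi>. X k \<xi> *\<^sub>R fourier (f1 t) \<xi>))\<^sup>2
                          + (Linf_norm (\<lambda>\<xi>. X k \<xi> *\<^sub>R fourier (f2 t) \<xi>))\<^sup>2) \<partial>lebesgue) (1 / 2))"


section \<open>Inertial range\<close>

definition E_K :: "real \<Rightarrow> real \<Rightarrow> real \<Rightarrow> real" where
  "E_K C0 \<epsilon> k = C0 * \<epsilon> powr (2/3) * k powr (- 5/3)"

text \<open>\<open>r1\<close> and \<open>r2\<close> stand for $R_1(T)$ and $R_2(T)$. The bound involving \<open>1 / k\<^sup>2\<close> is meant
  for positive \<open>k\<close>, which is also where the Kolmogorov function is defined.\<close>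

definition spectral_region :: "real \<Rightarrow> real \<Rightarrow> real \<Rightarrow> real \<Rightarrow> real \<Rightarrow> (real \<times> real) set" where
  "spectral_region \<nu> \<eta> T r1 r2 =
     {(k, E). 0 < k \<and> 0 \<le> E \<and> E \<le> 4 * pi * r1\<^sup>2 \<and> E \<le> 4 * pi * r2\<^sup>2 / (min \<nu> \<eta> * T * k\<^sup>2)}"

definition K41_set ::
  "real \<Rightarrow> real \<Rightarrow> real \<Rightarrow> real \<Rightarrow> real \<Rightarrow> real \<Rightarrow> real \<Rightarrow> (real \<times> real) set" where
  "K41_set C0 \<epsilon> \<nu> \<eta> T r1 r2 =
     {(k, E). 0 < k \<and> E = E_K C0 \<epsilon> k} \<inter> spectral_region \<nu> \<eta> T r1 r2"

definition inertial_range ::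
  "real \<Rightarrow> real \<Rightarrow> real \<Rightarrow> real \<Rightarrow> real \<Rightarrow> real \<Rightarrow> real \<Rightarrow> real set" where
  "inertial_range C0 \<epsilon> \<nu> \<eta> T r1 r2 =
     {k. 0 < k \<and> (k, E_K C0 \<epsilon> k) \<in> K41_set C0 \<epsilon> \<nu> \<eta> T r1 r2}"

end

theory Submission
  imports Defs
begin

text \<open>Write \<open>m = min \<nu> \<eta>\<close>, \<open>r1 = R1 T\<close>, \<open>r2 = R2 T\<close>. A wave number \<open>k\<close> of the inertial range satisfies
  two inequalities, which say that the Kolmogorov curve lies below the plateau of the region,
  $C_0\epsilon^{2/3}k^{-5/3}\le 4\pi r_1^2$, and below its parabolic tail,
  $C_0\epsilon^{2/3}k^{-5/3}\le 4\pi r_2^2/(mTk^2)$. As $k^{-5/3}$ decays, the plateau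
  excludes small \<open>k\<close>: solving the first inequality for \<open>k\<close> gives the lower bound. As it decays more
  slowly than $k^{-2}$, the tail excludes large \<open>k\<close>: solving the second one for \<open>k\<close> gives the
  upper bound. Finally, the geometric mean of the two inequalities with weights $1/6$ and $5/6$ has
  the factor $k^{-2\cdot 5/6}=k^{-5/3}$ on its right side, so \<open>k\<close> cancels, and what remains is the
  necessary condition on the parameters.

  Taking these powers requires that \<open>r1 > 0\<close> and \<open>r2 \<ge> 0\<close>. The first follows from the strict upper bound
  for \<open>h_p\<close>, whose left side is nonnegative; the second holds because \<open>R2 T\<close> is the larger root of
  $x^2-R_3(T)\,x-R_1(0)^2=0$, a quadratic whose roots have a product that is at most zero.\<close>

lemma E_K_pos: "C0 > 0 \<Longrightarrow> \<epsilon> > 0 \<Longrightarrow> k > 0 \<Longrightarrow> E_K C0 \<epsilon> k > 0"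
  by (simp add: E_K_def)

lemma inertial_rangeD:
  assumes "k \<in> inertial_range C0 \<epsilon> \<nu> \<eta> T r1 r2"
  shows "0 < k" and "E_K C0 \<epsilon> k \<le> 4 * pi * r1\<^sup>2"
    and "E_K C0 \<epsilon> k \<le> 4 * pi * r2\<^sup>2 / (min \<nu> \<eta> * T * k\<^sup>2)"
  using assms by (auto simp: inertial_range_def K41_set_def spectral_region_def)

lemma K41_set_empty_iff: "K41_set C0 \<epsilon> \<nu> \<eta> T r1 r2 = {} \<longleftrightarrow> inertial_range C0 \<epsilon> \<nu> \<eta> T r1 r2 = {}"
  by (auto simp: inertial_range_def K41_set_def)

text \<open>Where the Kolmogorov curve lies below the plateau, $C_0\epsilon^{2/3}\le 4\pi r_1^2k^{5/3}$,
  and the power $3/5$ of this inequality isolates \<open>k\<close>.\<close>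

lemma wave_number_ge_if_E_K_le_plateau:
  assumes "C0 > 0" "\<epsilon> > 0" "k > 0" "P > 0" and le: "E_K C0 \<epsilon> k \<le> P"
  shows "C0 powr (3/5) * \<epsilon> powr (2/5) / P powr (3/5) \<le> k"
proof -
  have "C0 * \<epsilon> powr (2/3) \<le> P * k powr (5/3)"
    using le \<open>k > 0\<close> by (simp add: E_K_def powr_minus field_simps)
  then have "(C0 * \<epsilon> powr (2/3)) powr (3/5) \<le> (P * k powr (5/3)) powr (3/5)"
    using assms by (intro powr_mono2) auto
  then have "C0 powr (3/5) * \<epsilon> powr (2/5) \<le> P powr (3/5) * k"
    using assms by (simp add: powr_mult powr_powr)
  then show ?thesis
    using \<open>P > 0\<close> by (simp add: field_simps)
qed

text \<open>Where the Kolmogorov curve lies below the tail $Q/k^2$, multiplication by $k^2$ leaves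
  $C_0\epsilon^{2/3}k^{1/3}\le Q$, and the cube of this inequality isolates \<open>k\<close>.\<close>

lemma wave_number_le_if_E_K_le_tail:
  assumes "C0 > 0" "\<epsilon> > 0" "k > 0" and le: "E_K C0 \<epsilon> k \<le> Q / k\<^sup>2"
  shows "k \<le> (Q / C0) ^ 3 / \<epsilon>\<^sup>2"
proof -
  have "k powr (-5/3) * k\<^sup>2 = k powr (1/3)"
    using \<open>k > 0\<close> by (simp flip: powr_numeral powr_add)
  then have "E_K C0 \<epsilon> k * k\<^sup>2 = C0 * \<epsilon> powr (2/3) * k powr (1/3)"
    by (simp add: E_K_def mult.assoc)
  moreover have "E_K C0 \<epsilon> k * k\<^sup>2 \<le> Q"
    using le \<open>k > 0\<close> by (simp add: pos_le_divide_eq)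
  ultimately have "(C0 * \<epsilon> powr (2/3) * k powr (1/3)) ^ 3 \<le> Q ^ 3"
    using assms by (intro power_mono) auto
  moreover have "(\<epsilon> powr (2/3)) ^ 3 = \<epsilon>\<^sup>2" "(k powr (1/3)) ^ 3 = k"
    using assms by (simp_all add: powr_powr flip: powr_numeral)
  ultimately show ?thesis
    using assms by (simp add: power_mult_distrib power_divide field_simps)
qed

text \<open>The weighted geometric mean is taken as the product of the powers $1/6$ and $5/6$ of the two
  bounds. The weight of the tail is the one for which the exponent of \<open>k\<close> agrees on both sides.\<close>

lemma amplitude_le_if_E_K_le_plateau_tail:
  assumes "C0 > 0" "\<epsilon> > 0" "k > 0" "P \<ge> 0" "Q \<ge> 0"
    and plateau: "E_K C0 \<epsilon> k \<le> P" and tail: "E_K C0 \<epsilon> k \<le> Q / k\<^sup>2"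
  shows "C0 * \<epsilon> powr (2/3) \<le> P powr (1/6) * Q powr (5/6)"
proof -
  have pos: "E_K C0 \<epsilon> k > 0"
    using assms by (simp add: E_K_pos)
  have "E_K C0 \<epsilon> k = E_K C0 \<epsilon> k powr (1/6) * E_K C0 \<epsilon> k powr (5/6)"
    using pos by (simp flip: powr_add)
  also have "\<dots> \<le> P powr (1/6) * (Q / k\<^sup>2) powr (5/6)"
    using pos plateau tail by (intro mult_mono powr_mono2) auto
  also have "(Q / k\<^sup>2) powr (5/6) = Q powr (5/6) * k powr (-5/3)"
    using \<open>k > 0\<close> \<open>Q \<ge> 0\<close> by (simp add: powr_divide powr_powr powr_minus field_simps flip: powr_numeral)
  finally show ?thesis
    using \<open>k > 0\<close> by (simp add: E_K_def mult.assoc)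
qed

theorem theorem3p5:
  fixes \<nu> \<eta> Rad C0 \<epsilon> T :: real
    and f1 f2 u b :: "real \<Rightarrow> vfield"
    and u0 b0 :: vfield
    and R R1 R2 R3 :: "real \<Rightarrow> real"
    and \<delta> :: "vec3 \<Rightarrow> real"
    and X :: "vec3 \<Rightarrow> vec3 \<Rightarrow> real"
  assumes "\<nu> > 0" and "\<eta> > 0"
    and forces: "\<And>t. t \<ge> 0 \<Longrightarrow> f1 t \<in> Hm1_L2 \<and> f2 t \<in> Hm1_L2"
      "\<And>t. t \<ge> 0 \<Longrightarrow> weakly_div_free (f1 t) \<and> weakly_div_free (f2 t)"
      "\<And>T. T > 0 \<Longrightarrow> f1 \<in> Linf_time {0..<T} Hm1_L2 (\<lambda>f. Hm1_norm f + L2_norm f)"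
      "\<And>T. T > 0 \<Longrightarrow> f2 \<in> Linf_time {0..<T} Hm1_L2 (\<lambda>f. Hm1_norm f + L2_norm f)"
    and solution: "mhd_weak_solution \<nu> \<eta> f1 f2 u0 b0 u b"
    and data_in_ball: "sqrt ((L2_norm u0)\<^sup>2 + (L2_norm b0)\<^sup>2) \<le> Rad"
    and R_nonneg: "\<And>t. t \<ge> 0 \<Longrightarrow> R t \<ge> 0"
    and R_energy: "\<And>T. T > 0 \<Longrightarrow>
      (L2_norm (u T))\<^sup>2 + (L2_norm (b T))\<^sup>2
      + min \<nu> \<eta> * (LINT s:{0..T}|lebesgue. (L2_norm (weak_grad (u s)))\<^sup>2 + (L2_norm (weak_grad (b s)))\<^sup>2)
      \<le> (R T)\<^sup>2"
    and R_fourier: "\<And>t. t \<ge> 0 \<Longrightarrow>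
      (L2_norm (fourier (u t)))\<^sup>2 + (L2_norm (fourier (b t)))\<^sup>2 \<le> (R t)\<^sup>2"
    and \<delta>: "\<And>k. k \<noteq> 0 \<Longrightarrow> 0 < \<delta> k \<and> \<delta> k < norm k / (2 * sqrt 3)"
    and cutoff: "\<And>k. k \<noteq> 0 \<Longrightarrow> is_cutoff k (\<delta> k) (X k)"
    and R1_mono: "mono_on {0..} R1"
    and R1_dynamic: "\<And>k p t. k \<noteq> 0 \<Longrightarrow> 2 \<le> p \<Longrightarrow> t \<ge> 0 \<Longrightarrow>
      ennreal (2 powr (1/p) * (2 * \<delta> k) powr (3/p) * (R t)\<^sup>2) + 2 * h_p X f1 f2 p k t
      < ennreal (min \<nu> \<eta> / 6 * R1 t)"
    and R1_initial: "\<And>k. k \<noteq> 0 \<Longrightarrow> (SUP p\<in>{2..}. e_p X u b p k 0) < ennreal (R1 0 / norm k)"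
    and unforced: "(\<forall>t\<ge>0. AE x in lebesgue. f1 t x = 0 \<and> f2 t x = 0) \<Longrightarrow>
      (\<forall>t\<ge>0. R t = Rad) \<and> (\<exists>c. \<forall>t\<ge>0. R1 t = c)"
    and F_finite: "\<And>T. T > 0 \<Longrightarrow> F_inf X f1 f2 T < \<infinity>"
    and R3_def: "\<And>T. T > 0 \<Longrightarrow>
      R3 T = 2 * (R T)\<^sup>2 / min \<nu> \<eta> + 2 * enn2real (F_inf X f1 f2 T) / sqrt (min \<nu> \<eta>)"
    and R2_def: "\<And>T. T > 0 \<Longrightarrow> R2 T = 1/2 * (R3 T + sqrt (4 * (R1 0)\<^sup>2 + (R3 T)\<^sup>2))"
    and "C0 > 0" and "\<epsilon> > 0" and "T > 0"
  shows
    "(K41_set C0 \<epsilon> \<nu> \<eta> T (R1 T) (R2 T) \<noteq> {} \<longrightarrow>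
        min \<nu> \<eta> powr (5/6) * C0 * \<epsilon> powr (2/3)
          \<le> 4 * pi * (R2 T / sqrt T) powr (5/3) * R1 T powr (1/3)) \<and>
     (\<forall>k\<in>inertial_range C0 \<epsilon> \<nu> \<eta> T (R1 T) (R2 T).
        C0 powr (3/5) * \<epsilon> powr (2/5) / (4 * pi * (R1 T)\<^sup>2) powr (3/5) \<le> k) \<and>
     (\<forall>k\<in>inertial_range C0 \<epsilon> \<nu> \<eta> T (R1 T) (R2 T).
        k \<le> (4 * pi / (C0 * min \<nu> \<eta>)) ^ 3 * (1 / \<epsilon>\<^sup>2) * ((R2 T) ^ 6 / T ^ 3))"
proof -
  define m where "m = min \<nu> \<eta>"
  have "m > 0"
    using \<open>\<nu> > 0\<close> \<open>\<eta> > 0\<close> by (simp add: m_def)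
  have R1_pos: "R1 T > 0"
  proof -
    (* Any nonzero wave vector and any exponent at least 2 would do here. *)
    have "0 < ennreal (m / 6 * R1 T)"
      using R1_dynamic[of "axis 1 1" 2 T] \<open>T > 0\<close> unfolding m_def
      by (intro le_less_trans[OF zero_le]) (auto simp: axis_eq_0_iff)
    then show ?thesis
      using \<open>m > 0\<close> by (simp add: zero_less_mult_iff)
  qed
  have R2_nonneg: "R2 T \<ge> 0"
  proof -
    have "\<bar>R3 T\<bar> \<le> sqrt (4 * (R1 0)\<^sup>2 + (R3 T)\<^sup>2)"
      by (rule real_le_rsqrt) simp
    then show ?thesis
      using R2_def[OF \<open>T > 0\<close>] by simp
  qed
  define P Q where "P = 4 * pi * (R1 T)\<^sup>2" and "Q = 4 * pi * (R2 T)\<^sup>2 / (m * T)"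
  have "P > 0" "Q \<ge> 0"
    using R1_pos \<open>m > 0\<close> \<open>T > 0\<close> by (simp_all add: P_def Q_def)
  let ?I = "inertial_range C0 \<epsilon> \<nu> \<eta> T (R1 T) (R2 T)"
  have range: "0 < k" "E_K C0 \<epsilon> k \<le> P" "E_K C0 \<epsilon> k \<le> Q / k\<^sup>2" if "k \<in> ?I" for k
    using inertial_rangeD[OF that] by (simp_all add: P_def Q_def m_def)

  have "m powr (5/6) * C0 * \<epsilon> powr (2/3)
      \<le> 4 * pi * (R2 T / sqrt T) powr (5/3) * R1 T powr (1/3)" if "?I \<noteq> {}"
  proof -
    obtain k where "k \<in> ?I"
      using \<open>?I \<noteq> {}\<close> by blast
    then have "C0 * \<epsilon> powr (2/3) \<le> P powr (1/6) * Q powr (5/6)"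
      using range \<open>C0 > 0\<close> \<open>\<epsilon> > 0\<close> \<open>P > 0\<close> \<open>Q \<ge> 0\<close>
      by (intro amplitude_le_if_E_K_le_plateau_tail[of _ _ k]) auto
    then have "m powr (5/6) * (C0 * \<epsilon> powr (2/3))
        \<le> m powr (5/6) * (P powr (1/6) * Q powr (5/6))"
      by (intro mult_left_mono) auto
    also have "P powr (1/6) = (4 * pi) powr (1/6) * R1 T powr (1/3)"
      using R1_pos by (simp add: P_def powr_mult powr_powr flip: powr_numeral)
    also have "m powr (5/6) * ((4 * pi) powr (1/6) * R1 T powr (1/3) * Q powr (5/6))
        = ((4 * pi) powr (1/6) * R1 T powr (1/3)) * (m * Q) powr (5/6)"
      using \<open>m > 0\<close> \<open>Q \<ge> 0\<close> by (simp add: powr_mult)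
    also have "m * Q = 4 * pi * (R2 T / sqrt T)\<^sup>2"
      using \<open>m > 0\<close> \<open>T > 0\<close> by (simp add: Q_def power_divide)
    also have "(4 * pi * (R2 T / sqrt T)\<^sup>2) powr (5/6)
        = (4 * pi) powr (5/6) * (R2 T / sqrt T) powr (5/3)"
    proof -
      have "((R2 T / sqrt T)\<^sup>2) powr (5/6) = (R2 T / sqrt T) powr (5/3)"
        using R2_nonneg \<open>T > 0\<close> by (simp add: powr_powr flip: powr_numeral)
      then show ?thesis
        by (simp add: powr_mult)
    qed
    also have "(4 * pi) powr (1/6) * R1 T powr (1/3) * ((4 * pi) powr (5/6) * (R2 T / sqrt T) powr (5/3))
        = ((4 * pi) powr (1/6) * (4 * pi) powr (5/6)) * (R2 T / sqrt T) powr (5/3) * R1 T powr (1/3)"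
      by (simp only: ac_simps)
    also have "(4 * pi) powr (1/6) * (4 * pi) powr (5/6) = 4 * pi"
      by (simp flip: powr_add)
    finally show ?thesis
      by (simp only: mult.assoc)
  qed
  moreover have "C0 powr (3/5) * \<epsilon> powr (2/5) / (4 * pi * (R1 T)\<^sup>2) powr (3/5) \<le> k"
    if "k \<in> ?I" for k
    using wave_number_ge_if_E_K_le_plateau[of C0 \<epsilon> k P] range[OF that] \<open>C0 > 0\<close> \<open>\<epsilon> > 0\<close> \<open>P > 0\<close>
    by (simp add: P_def)
  moreover have "k \<le> (4 * pi / (C0 * m)) ^ 3 * (1 / \<epsilon>\<^sup>2) * ((R2 T) ^ 6 / T ^ 3)" if "k \<in> ?I" for k
  proof -
    have "k \<le> (Q / C0) ^ 3 / \<epsilon>\<^sup>2"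
      using range[OF that] \<open>C0 > 0\<close> \<open>\<epsilon> > 0\<close> by (intro wave_number_le_if_E_K_le_tail)
    also have "\<dots> = (4 * pi / (C0 * m)) ^ 3 * (1 / \<epsilon>\<^sup>2) * ((R2 T) ^ 6 / T ^ 3)"
      by (simp add: Q_def power_mult_distrib power_divide flip: power_mult)
    finally show ?thesis .
  qed
  ultimately show ?thesis
    unfolding K41_set_empty_iff m_def by blast
qed

end
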